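(* Let $s\in(\frac12,1)$ and let $\mathcal I$ be a translation invariant, positively $1$-homogeneous nonlocal operator elliptic with respect to $\mathcal{K}_s$ (see context). Let $m>2s$ and $q>0$. Then there exists no bounded positive viscosity solution $u$ to $$-\mathcal I u=u^q|\nabla u|^m\quad\text{in }\mathbb{R}^n,$$ unless $u$ is a constant.
   Context: Fix $s\in(0,1)$ and $0<\lambda\leq\Lambda$. $\mathcal{K}_s=\mathcal{K}_s(\lambda,\Lambda)$ is the family of measurable kernels $K:\mathbb{R}^n\setminus\{0\}\to[0,\infty)$ with $\frac{\lambda}{|z|^{n+2s}}\leq K(z)\leq\frac{\Lambda}{|z|^{n+2s}}$ for $z\neq0$ (no symmetry is assumed). With $B$ the unit ball centered at $0$, for $K\in\mathcal{K}_s$ put $$L_Ku(x)=\int_{\mathbb{R}^n}\big[u(x+z)-u(x)-1_{\{2s\in[1,2)\}}1_B(z)\nabla u(x)\cdot z\big]K(z)\,dz .$$ Let $\omega_s(z)=(1+|z|)^{-n-2s}$, and let $L^1(\omega_s)$ be the functions integrable against $\omega_s$. $\mathcal I$ is a nonlocal operator which is translation invariant ($\mathcal I u_h(x)=\mathcal I u(x+h)$ for all $x,h$, where $u_h=u(\cdot+h)$), positively $1$-homogeneous, and elliptic with respect to $\mathcal{K}_s$, i.e. $$\inf_{K\in\mathcal{K}_s}(L_Ku(x)-L_Kv(x))\leq\mathcal I u(x)-\mathcal I v(x)\leq\sup_{K\in\mathcal{K}_s}(L_Ku(x)-L_Kv(x))$$ whenever $u,v\in C^{1,1}(x)\cap L^1(\omega_s)$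 (where $C^{1,1}(x)$ means $C^{1,1}$ at the point $x$). Viscosity solutions: let $\Omega\subseteq\mathbb{R}^n$ and $U\subseteq\mathbb{R}$ be open and consider $-\mathcal I u+H(x,u,\nabla u)=0$ in $\Omega$, with $H\in C(\mathbb{R}^n\times U\times\mathbb{R}^n)$. A measurable $u:\mathbb{R}^n\to U$ in $L^1(\omega_s)$, upper (resp. lower) semicontinuous in $\bar\Omega$, is a viscosity subsolution (resp. supersolution) if for each $x_0\in\Omega$ and $\varphi\in C^2(B_r(x_0))$, for some $r>0$, with $u(x_0)=\varphi(x_0)$ and $u\leq\varphi$ (resp. $u\geq\varphi$) in $B_r(x_0)$, one has $-\mathcal I v(x_0)+H(x_0,u(x_0),\nabla\varphi(x_0))\leq0$ (resp. $\geq0$), where $v=\varphi$ in $B_r(x_0)$ and $v=u$ elsewhere. A viscosity solution is both a sub- and a supersolution. *)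

theory Defs
  imports "HOL-Analysis.Analysis"
begin

text \<open>
  The ambient space is an arbitrary Euclidean space \<open>'a\<close>, of dimension \<open>n = DIM('a) \<ge> 1\<close>.
  Measurability and integration are with respect to the completed Lebesgue measure.
\<close>

section \<open>Nonlocal operators\<close>

text \<open>
  Kernels are total functions whose value at \<open>0\<close> is arbitrary and never matters, since the
  integrand of \<open>L_op\<close> below vanishes at \<open>z = 0\<close>.
\<close>

definition kernels :: "real \<Rightarrow> real \<Rightarrow> real \<Rightarrow> ('a::euclidean_space \<Rightarrow> real) set" where
  "kernels s lam Lam =
     {K \<in> borel_measurable lebesgue. \<forall>z. z \<noteq> 0 \<longrightarrow>
        lam / norm z powr (real DIM('a) + 2 * s) \<le> K z \<and>
        K z \<le> Lam / norm z powr (real DIM('a) + 2 * s)}"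

definition gradient :: "('a::euclidean_space \<Rightarrow> real) \<Rightarrow> 'a \<Rightarrow> 'a" where
  "gradient u x = (THE p. GDERIV u x :> p)"

definition L_op :: "real \<Rightarrow> ('a::euclidean_space \<Rightarrow> real) \<Rightarrow> ('a \<Rightarrow> real) \<Rightarrow> 'a \<Rightarrow> real" where
  "L_op s K u x =
     (LINT z|lebesgue.
        (u (x + z) - u x
          - indicator {1..<2} (2 * s) * indicator (ball 0 1) z * (gradient u x \<bullet> z)) * K z)"

definition weight :: "real \<Rightarrow> 'a::euclidean_space \<Rightarrow> real" where
  "weight s z = (1 + norm z) powr (- real DIM('a) - 2 * s)"

definition L1_weight :: "real \<Rightarrow> ('a::euclidean_space \<Rightarrow> real) set" where
  "L1_weight s = {u \<in> borel_measurable lebesgue. integrable lebesgue (\<lambda>z. u z * weight s z)}"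

text \<open>Functions that are \<open>C\<^sup>1\<^sup>,\<^sup>1\<close> at the single point \<open>x\<close>, in the sense of Caffarelli and Silvestre.\<close>

definition C11_at :: "'a::euclidean_space \<Rightarrow> ('a \<Rightarrow> real) set" where
  "C11_at x = {u. \<exists>p M r. r > 0 \<and>
     (\<forall>z. norm z < r \<longrightarrow> \<bar>u (x + z) - u x - p \<bullet> z\<bar> \<le> M * (norm z)\<^sup>2)}"

text \<open>
  A nonlocal operator is a total function \<open>I\<close> on functions; \<open>I u x\<close> is meaningful only
  for \<open>u \<in> C11_at x \<inter> L1_weight s\<close>, and every condition is restricted to this domain.
\<close>

definition translation_invariant ::
    "real \<Rightarrow> (('a::euclidean_space \<Rightarrow> real) \<Rightarrow> 'a \<Rightarrow> real) \<Rightarrow> bool" where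
  "translation_invariant s I \<longleftrightarrow>
     (\<forall>u x h. u \<in> C11_at (x + h) \<inter> L1_weight s \<longrightarrow> I (\<lambda>y. u (y + h)) x = I u (x + h))"

definition pos_homogeneous ::
    "real \<Rightarrow> (('a::euclidean_space \<Rightarrow> real) \<Rightarrow> 'a \<Rightarrow> real) \<Rightarrow> bool" where
  "pos_homogeneous s I \<longleftrightarrow>
     (\<forall>u x t. t > 0 \<longrightarrow> u \<in> C11_at x \<inter> L1_weight s \<longrightarrow> I (\<lambda>y. t * u y) x = t * I u x)"

text \<open>
  For \<open>0 < s < 1\<close>, \<open>0 < lam \<le> Lam\<close> and \<open>u\<close>, \<open>v\<close> as below, the family of reals
  \<open>L_op s K u x - L_op s K v x\<close> over the kernels \<open>K\<close> is nonempty and bounded, so the real-valued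
  infimum and supremum are the genuine ones.
\<close>

definition elliptic ::
    "real \<Rightarrow> real \<Rightarrow> real \<Rightarrow> (('a::euclidean_space \<Rightarrow> real) \<Rightarrow> 'a \<Rightarrow> real) \<Rightarrow> bool" where
  "elliptic s lam Lam I \<longleftrightarrow>
     (\<forall>u v x. u \<in> C11_at x \<inter> L1_weight s \<longrightarrow> v \<in> C11_at x \<inter> L1_weight s \<longrightarrow>
        (INF K\<in>kernels s lam Lam. L_op s K u x - L_op s K v x) \<le> I u x - I v x \<and>
        I u x - I v x \<le> (SUP K\<in>kernels s lam Lam. L_op s K u x - L_op s K v x))"


section \<open>Viscosity solutions\<close>

definition C2_on :: "'a::euclidean_space set \<Rightarrow> ('a \<Rightarrow> real) set" where
  "C2_on S = {f. \<exists>(g :: 'a \<Rightarrow> 'a) (D2 :: 'a \<Rightarrow> 'a \<Rightarrow>\<^sub>L 'a).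
     (\<forall>x\<in>S. GDERIV f x :> g x) \<and>
     (\<forall>x\<in>S. (g has_derivative blinfun_apply (D2 x)) (at x)) \<and>
     continuous_on S D2}"

definition usc_on :: "'a::topological_space set \<Rightarrow> ('a \<Rightarrow> real) \<Rightarrow> bool" where
  "usc_on S u \<longleftrightarrow> (\<forall>x\<in>S. \<forall>a. u x < a \<longrightarrow> (\<forall>\<^sub>F y in at x within S. u y < a))"

definition lsc_on :: "'a::topological_space set \<Rightarrow> ('a \<Rightarrow> real) \<Rightarrow> bool" where
  "lsc_on S u \<longleftrightarrow> (\<forall>x\<in>S. \<forall>a. a < u x \<longrightarrow> (\<forall>\<^sub>F y in at x within S. a < u y))"

definition glue :: "'a::metric_space \<Rightarrow> real \<Rightarrow> ('a \<Rightarrow> real) \<Rightarrow> ('a \<Rightarrow> real) \<Rightarrow> 'a \<Rightarrow> real" where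
  "glue x0 r \<phi> u = (\<lambda>y. if y \<in> ball x0 r then \<phi> y else u y)"

text \<open>
  Sub- and supersolutions of \<open>- I u + H(x, u, \<nabla>u) = 0\<close> in \<open>\<Omega>\<close>, for \<open>\<Omega>\<close> and \<open>U\<close> open and \<open>H\<close>
  continuous on \<open>UNIV \<times> U \<times> UNIV\<close>.  A function that is \<open>C\<^sup>2\<close> in an open ball may fail to be
  integrable near its boundary; the test is imposed only if the glued function belongs to
  \<open>L1_weight s\<close>, so that \<open>I\<close> is evaluated only where it is defined.
\<close>

definition visc_subsolution ::
    "real \<Rightarrow> (('a::euclidean_space \<Rightarrow> real) \<Rightarrow> 'a \<Rightarrow> real) \<Rightarrow> ('a \<Rightarrow> real \<Rightarrow> 'a \<Rightarrow> real) \<Rightarrow>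
     'a set \<Rightarrow> real set \<Rightarrow> ('a \<Rightarrow> real) \<Rightarrow> bool" where
  "visc_subsolution s I H \<Omega> U u \<longleftrightarrow>
     range u \<subseteq> U \<and> u \<in> L1_weight s \<and> usc_on (closure \<Omega>) u \<and>
     (\<forall>x0\<in>\<Omega>. \<forall>r>0. \<forall>\<phi>\<in>C2_on (ball x0 r).
        u x0 = \<phi> x0 \<longrightarrow> (\<forall>y\<in>ball x0 r. u y \<le> \<phi> y) \<longrightarrow> glue x0 r \<phi> u \<in> L1_weight s \<longrightarrow>
        - I (glue x0 r \<phi> u) x0 + H x0 (u x0) (gradient \<phi> x0) \<le> 0)"

definition visc_supersolution ::
    "real \<Rightarrow> (('a::euclidean_space \<Rightarrow> real) \<Rightarrow> 'a \<Rightarrow> real) \<Rightarrow> ('a \<Rightarrow> real \<Rightarrow> 'a \<Rightarrow> real) \<Rightarrow>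
     'a set \<Rightarrow> real set \<Rightarrow> ('a \<Rightarrow> real) \<Rightarrow> bool" where
  "visc_supersolution s I H \<Omega> U u \<longleftrightarrow>
     range u \<subseteq> U \<and> u \<in> L1_weight s \<and> lsc_on (closure \<Omega>) u \<and>
     (\<forall>x0\<in>\<Omega>. \<forall>r>0. \<forall>\<phi>\<in>C2_on (ball x0 r).
        u x0 = \<phi> x0 \<longrightarrow> (\<forall>y\<in>ball x0 r. \<phi> y \<le> u y) \<longrightarrow> glue x0 r \<phi> u \<in> L1_weight s \<longrightarrow>
        0 \<le> - I (glue x0 r \<phi> u) x0 + H x0 (u x0) (gradient \<phi> x0))"

definition visc_solution ::
    "real \<Rightarrow> (('a::euclidean_space \<Rightarrow> real) \<Rightarrow> 'a \<Rightarrow> real) \<Rightarrow> ('a \<Rightarrow> real \<Rightarrow> 'a \<Rightarrow> real) \<Rightarrow>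
     'a set \<Rightarrow> real set \<Rightarrow> ('a \<Rightarrow> real) \<Rightarrow> bool" where
  "visc_solution s I H \<Omega> U u \<longleftrightarrow>
     visc_subsolution s I H \<Omega> U u \<and> visc_supersolution s I H \<Omega> U u"

end

theory Submission
  imports Defs
begin

text \<open>
  Double the variables: with \<open>\<alpha> = (m - 2 s) / (m - 1)\<close>, which lies in \<open>(0, 1)\<close> since \<open>2 s > 1\<close>,
  consider a maximum point \<open>(x, y)\<close> of \<open>u x - u y - L |x - y|\<^sup>\<alpha>\<close>, up to a small penalization, and
  put \<open>r = |x - y|\<close>.  The concavity of \<open>t \<mapsto> t\<^sup>\<alpha>\<close> makes the difference of the operators at \<open>x\<close>
  and \<open>y\<close> at most \<open>- c L r\<^sup>\<alpha>\<^sup>-\<^sup>2\<^sup>s\<close>; the gradients at both points agree up to the penalization, so the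
  compensators cancel and no symmetry of the kernels is needed.  The equation bounds the same
  difference from below by \<open>- C (L r\<^sup>\<alpha>\<^sup>-\<^sup>1)\<^sup>m\<close>.  The exponent \<open>\<alpha>\<close> is chosen so that both powers of \<open>r\<close>
  coincide, whence \<open>L\<^sup>m\<^sup>-\<^sup>1\<close> is bounded below.  So \<open>u x - u y \<le> L |x - y|\<^sup>\<alpha>\<close> for all small \<open>L > 0\<close>,
  and \<open>L \<rightarrow> 0\<close> shows that \<open>u\<close> is constant.
\<close>

section \<open>Integrability of the kernels\<close>

lemma ball_borel [measurable]: "ball (x::'a::metric_space) r \<in> sets borel"
  by (rule borel_open) simp

text \<open>The pointwise bound puts \<open>f\<close> below the sum of \<open>c k\<close> times the
  indicator of the ball of radius \<open>R k\<close>, whose integral is a series of ball volumes.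
  Dyadic radii make it geometric, in place of polar coordinates.\<close>

lemma integrable_by_balls:
  fixes f :: "'a::euclidean_space \<Rightarrow> real" and c R :: "nat \<Rightarrow> real"
  assumes f: "f \<in> borel_measurable borel" and f0: "\<And>z. 0 \<le> f z"
    and c0: "\<And>k. 0 \<le> c k" and R0: "\<And>k. 0 \<le> R k"
    and bound: "\<And>z. f z \<noteq> 0 \<Longrightarrow> \<exists>k. norm z < R k \<and> f z \<le> c k"
    and sm: "summable (\<lambda>k. c k * R k ^ DIM('a))"
  shows "integrable lborel f"
proof (rule integrableI_nonneg)
  have "(\<integral>\<^sup>+z. ennreal (f z) \<partial>lborel)
      \<le> (\<integral>\<^sup>+z. (\<Sum>k. ennreal (c k) * indicator (ball (0::'a) (R k)) z) \<partial>lborel)"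
  proof (rule nn_integral_mono)
    fix z :: 'a
    show "ennreal (f z) \<le> (\<Sum>k. ennreal (c k) * indicator (ball 0 (R k)) z)"
    proof (cases "f z = 0")
      case False
      then obtain k where k: "norm z < R k" "f z \<le> c k"
        using bound by blast
      have "ennreal (f z) \<le> ennreal (c k) * indicator (ball 0 (R k)) z"
        using k by (simp add: ennreal_leI)
      also have "\<dots> \<le> (\<Sum>k. ennreal (c k) * indicator (ball 0 (R k)) z)"
        using sum_le_suminf[of "\<lambda>k. ennreal (c k) * indicator (ball 0 (R k)) z" "{k}"]
        by (simp del: sum_mult_indicator)
      finally show ?thesis .
    qed simp
  qed
  also have "\<dots> = (\<Sum>k. \<integral>\<^sup>+z. ennreal (c k) * indicator (ball (0::'a) (R k)) z \<partial>lborel)"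
    by (rule nn_integral_suminf) measurable
  also have "\<dots> = (\<Sum>k. ennreal (unit_ball_vol (DIM('a)) * (c k * R k ^ DIM('a))))"
    using R0 c0 by (simp add: nn_integral_cmult_indicator emeasure_ball ennreal_mult'[symmetric] ac_simps)
  also have "\<dots> < \<infinity>"
    using summable_mult[OF sm, of "unit_ball_vol (DIM('a))"] c0 R0
    by (subst suminf_ennreal2) (auto intro!: mult_nonneg_nonneg)
  finally show "(\<integral>\<^sup>+z. ennreal (f z) \<partial>lborel) < \<infinity>" .
qed (use f f0 in auto)

text \<open>The numerator models the increments to be integrated: quadratic at the origin after
  compensation, at most linear at infinity, which leaves room for a Lipschitz penalization. The rest
  is the kernel bound up to a constant.\<close>

definition levy_weight :: "real \<Rightarrow> 'a::euclidean_space \<Rightarrow> real" where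
  "levy_weight s z = min (norm z) ((norm z)\<^sup>2) / norm z powr (real DIM('a) + 2 * s)"

lemma levy_weight_measurable [measurable]: "levy_weight s \<in> borel_measurable borel"
  unfolding levy_weight_def[abs_def] by measurable

lemma levy_weight_nonneg: "0 \<le> levy_weight s z"
  by (simp add: levy_weight_def)

lemma min_norm_square:
  "norm z < 1 \<Longrightarrow> min (norm z) ((norm z)\<^sup>2) = (norm z)\<^sup>2"
  "1 \<le> norm z \<Longrightarrow> min (norm z) ((norm z)\<^sup>2) = norm z"
proof -
  show "min (norm z) ((norm z)\<^sup>2) = (norm z)\<^sup>2" if "norm z < 1"
    using that by (intro min_absorb2) (simp add: power2_eq_square mult_left_le_one_le)
  show "min (norm z) ((norm z)\<^sup>2) = norm z" if "1 \<le> norm z"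
    using that by (intro min_absorb1 self_le_power) auto
qed

text \<open>On the shell 2^(-k-1) \<le> |z| < 2^(-k) the weight is of order 2^(k(n+2s-2)) and the
  volume of order 2^(-kn). The resulting ratio 2^(2s-2) is below 1 because s < 1.\<close>

lemma integrable_levy_weight_inside:
  assumes "s < 1" "0 < s"
  shows "integrable lborel (\<lambda>z::'a::euclidean_space. indicator (ball 0 1) z * levy_weight s z)"
proof (rule integrable_by_balls)
  let ?b = "real DIM('a) + 2 * s"
  show "\<exists>k. norm z < 2 powr (- real k) \<and>
      indicator (ball 0 1) z * levy_weight s z \<le> 2 powr ((real k + 1) * ?b - 2 * real k)"
    if nz: "indicator (ball 0 1) z * levy_weight s z \<noteq> 0" for z :: 'a
  proof -
    have z: "norm z < 1" "z \<noteq> 0"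
      using nz by (auto simp: levy_weight_def split: split_indicator_asm)
    define t where "t = - log 2 (norm z)"
    have t: "norm z = 2 powr (- t)" "t > 0"
      using z by (auto simp: t_def)
    \<comment> \<open>The largest integer strictly below \<open>t\<close>, not the floor: the ball
      of radius 2^(-k) is open and must contain \<open>z\<close>.\<close>
    define k where "k = nat (\<lceil>t\<rceil> - 1)"
    have k: "real k < t" "t \<le> real k + 1"
      using t(2) unfolding k_def by linarith+
    have "(norm z)\<^sup>2 = 2 powr (- 2 * t)"
      by (simp add: t(1) power2_eq_square flip: powr_add)
    moreover have "norm z powr ?b = 2 powr (- t * ?b)"
      by (simp only: t(1) powr_powr)
    ultimately have "levy_weight s z = 2 powr (- 2 * t - (- t * ?b))"
      unfolding levy_weight_def min_norm_square(1)[OF z(1)] by (simp only: powr_diff)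
    also have "\<dots> = 2 powr (t * ?b - 2 * t)"
      by simp
    also have "t * ?b - 2 * t \<le> (real k + 1) * ?b - 2 * real k"
      using k assms by (intro diff_mono mult_right_mono) auto
    finally show ?thesis
      using k z t by (intro exI[of _ k]) simp
  qed
  have "2 powr ((real k + 1) * ?b - 2 * real k) * (2 powr (- real k)) ^ DIM('a)
      = 2 powr ?b * (2 powr (2 * s - 2)) ^ k" for k
    by (simp add: powr_realpow[symmetric] powr_powr algebra_simps flip: powr_add)
  moreover have "summable (\<lambda>k. 2 powr ?b * (2 powr (2 * s - 2)) ^ k)"
    using assms powr_less_mono[of "2 * s - 2" 0 2]
    by (intro summable_mult summable_geometric) auto
  ultimately show "summable (\<lambda>k. 2 powr ((real k + 1) * ?b - 2 * real k) * (2 powr (- real k)) ^ DIM('a))"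
    by simp
qed (auto simp: levy_weight_nonneg)

text \<open>On the shell 2^k \<le> |z| < 2^(k+1) the weight is of order 2^(k(1-n-2s)) and the volume
  of order 2^(kn). The ratio 2^(1-2s) is below 1 because 2s > 1.\<close>

lemma integrable_levy_weight_outside:
  assumes "1/2 < s"
  shows "integrable lborel (\<lambda>z::'a::euclidean_space. indicator (- ball 0 1) z * levy_weight s z)"
proof (rule integrable_by_balls)
  let ?b = "real DIM('a) + 2 * s"
  show "\<exists>k. norm z < 2 powr (real k + 1) \<and>
      indicator (- ball 0 1) z * levy_weight s z \<le> 2 powr (real k + 1 - real k * ?b)"
    if nz: "indicator (- ball 0 1) z * levy_weight s z \<noteq> 0" for z :: 'a
  proof -
    have z: "norm z \<ge> 1" "z \<noteq> 0"
      using nz by (auto simp: levy_weight_def split: split_indicator_asm)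
    define t where "t = log 2 (norm z)"
    have t: "norm z = 2 powr t" "t \<ge> 0"
      using z by (auto simp: t_def)
    define k where "k = nat \<lfloor>t\<rfloor>"
    have k: "real k \<le> t" "t < real k + 1"
      using t(2) unfolding k_def by linarith+
    have "levy_weight s z = 2 powr (t - t * ?b)"
      using z min_norm_square(2)[OF z(1)]
      by (simp add: levy_weight_def t powr_powr powr_diff)
    also have "t - t * ?b \<le> real k + 1 - real k * ?b"
      using k assms by (intro diff_mono mult_right_mono) auto
    finally show ?thesis
      using k z t by (intro exI[of _ k]) simp
  qed
  have "2 powr (real k + 1 - real k * ?b) * (2 powr (real k + 1)) ^ DIM('a)
      = 2 powr (1 + real DIM('a)) * (2 powr (1 - 2 * s)) ^ k" for k
    by (simp add: powr_realpow[symmetric] powr_powr algebra_simps flip: powr_add)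
  moreover have "summable (\<lambda>k. 2 powr (1 + real DIM('a)) * (2 powr (1 - 2 * s)) ^ k)"
    using assms powr_less_mono[of "1 - 2 * s" 0 2]
    by (intro summable_mult summable_geometric) auto
  ultimately show "summable (\<lambda>k. 2 powr (real k + 1 - real k * ?b) * (2 powr (real k + 1)) ^ DIM('a))"
    by simp
qed (auto simp: levy_weight_nonneg)

lemma integrable_levy_weight:
  assumes "1/2 < s" "s < 1"
  shows "integrable lebesgue (levy_weight s :: 'a::euclidean_space \<Rightarrow> real)"
proof -
  have "integrable lborel (levy_weight s :: 'a \<Rightarrow> real)"
    by (rule Bochner_Integration.integrable_bound[OF Bochner_Integration.integrable_add[OF integrable_levy_weight_inside
              integrable_levy_weight_outside]])
       (use assms in \<open>auto simp: indicator_def\<close>)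
  then show ?thesis
    by (simp add: integrable_completion borel_measurable_integrable)
qed

text \<open>\<open>weight s\<close> is at most 1 in the unit ball and at most
  \<open>levy_weight s\<close> outside it, and both majorants are integrable there.\<close>

lemma bounded_in_L1_weight:
  fixes u :: "'a::euclidean_space \<Rightarrow> real"
  assumes s: "1/2 < s" "s < 1"
    and u: "u \<in> borel_measurable borel" "\<And>x. \<bar>u x\<bar> \<le> B"
  shows "u \<in> L1_weight s"
proof -
  have w: "0 \<le> weight s z" "weight s z \<le> indicator (ball 0 1) z + levy_weight s z" for z :: 'a
  proof -
    show "0 \<le> weight s z"
      by (simp add: weight_def)
    show "weight s z \<le> indicator (ball 0 1) z + levy_weight s z"
    proof (cases "norm z < 1")
      case True
      have "weight s z \<le> (1 + norm z) powr 0"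
        unfolding weight_def using s by (intro powr_mono) auto
      also have "\<dots> = 1"
        by (simp add: add_pos_nonneg order_less_imp_not_eq2)
      finally show ?thesis
        using True levy_weight_nonneg[of s z] by simp
    next
      case False
      have "weight s z \<le> norm z powr (- real DIM('a) - 2 * s)"
        unfolding weight_def using s False by (intro powr_mono2') auto
      also have "\<dots> = 1 / norm z powr (real DIM('a) + 2 * s)"
        by (simp add: powr_minus_divide[symmetric])
      also have "\<dots> \<le> levy_weight s z"
        unfolding levy_weight_def using False min_norm_square(2)[of z]
        by (intro divide_right_mono) auto
      finally show ?thesis
        using False by simp
    qed
  qed
  have meas: "(\<lambda>z::'a. u z * weight s z) \<in> borel_measurable borel"
    using u by (auto simp: weight_def)
  have "integrable lebesgue (\<lambda>z::'a. B * (indicator (ball 0 1) z + levy_weight s z))"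
    by (intro integrable_mult_right Bochner_Integration.integrable_add integrable_levy_weight s
        integrable_real_indicator) (auto simp: emeasure_ball)
  then have "integrable lebesgue (\<lambda>z. u z * weight s z)"
  proof (rule Bochner_Integration.integrable_bound)
    show "(\<lambda>z::'a. u z * weight s z) \<in> borel_measurable lebesgue"
      using meas by (simp add: measurable_completion)
    have "\<bar>u z * weight s z\<bar> \<le> \<bar>B * (indicator (ball 0 1) z + levy_weight s z)\<bar>" for z
      unfolding abs_mult using u(2)[of z] w[of z] by (intro mult_mono) auto
    then show "AE x in lebesgue. norm (u x * weight s x)
        \<le> norm (B * (indicator (ball 0 1) x + levy_weight s x))"
      by simp
  qed
  then show ?thesis
    using u by (simp add: L1_weight_def measurable_completion)
qed

text \<open>Dominated convergence along the radii 1/(N+1); monotonicity in the radius covers all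
  smaller balls. This makes the cost of gluing in a paraboloid arbitrarily small.\<close>

lemma levy_weight_small_ball:
  assumes "1/2 < s" "s < 1" "0 < e"
  shows "\<exists>d0>0. \<forall>d. 0 < d \<longrightarrow> d \<le> d0 \<longrightarrow>
    (LINT z|lebesgue. indicator (ball (0::'a::euclidean_space) d) z * levy_weight s z) < e"
proof -
  let ?f = "\<lambda>d z. indicator (ball (0::'a) d) z * levy_weight s z"
  have "((\<lambda>d. integral\<^sup>L lebesgue (?f (inverse (real (Suc d))))) \<longlonglongrightarrow> integral\<^sup>L lebesgue (\<lambda>z::'a. 0::real))"
  proof (rule integral_dominated_convergence[where w="levy_weight s"])
    show "AE z in lebesgue. (\<lambda>d. ?f (inverse (real (Suc d))) z) \<longlonglongrightarrow> 0"
    proof (rule AE_I2)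
      fix z :: 'a
      show "(\<lambda>d. ?f (inverse (real (Suc d))) z) \<longlonglongrightarrow> 0"
      \<comment> \<open>A point \<open>z \<noteq> 0\<close> eventually leaves the shrinking balls;
        at the origin, which never leaves them, the weight is 0.\<close>
      proof (cases "z = 0")
        case False
        then have "\<forall>\<^sub>F d in sequentially. inverse (real (Suc d)) < norm z"
          using LIMSEQ_inverse_real_of_nat by (intro order_tendstoD) auto
        then show ?thesis
          by (intro tendsto_eventually) (auto elim!: eventually_mono)
      qed (simp add: levy_weight_def)
    qed
    show "integrable lebesgue (levy_weight s :: 'a \<Rightarrow> real)"
      using assms(1,2) by (rule integrable_levy_weight)
    show "(\<lambda>z. 0 :: real) \<in> borel_measurable lebesgue"
      by simp
    show "?f (inverse (real (Suc d))) \<in> borel_measurable lebesgue" for d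
      by (simp add: measurable_completion)
    show "AE z in lebesgue. norm (?f (inverse (real (Suc d))) z) \<le> levy_weight s z" for d
      by (simp add: levy_weight_nonneg indicator_def)
  qed
  then have "\<forall>\<^sub>F d in sequentially. integral\<^sup>L lebesgue (?f (inverse (real (Suc d)))) < e"
    using assms by (intro order_tendstoD) auto
  then obtain N where N: "integral\<^sup>L lebesgue (?f (inverse (real (Suc N)))) < e"
    by (auto simp: eventually_sequentially)
  have int: "integrable lebesgue (?f d)" for d
    using integrable_levy_weight[OF assms(1,2), where 'a='a]
    by (rule Bochner_Integration.integrable_bound)
       (use levy_weight_nonneg in \<open>auto simp: measurable_completion indicator_def\<close>)
  show ?thesis
  proof (intro exI conjI allI impI)
    fix d assume d: "0 < d" "d \<le> inverse (real (Suc N))"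
    have "integral\<^sup>L lebesgue (?f d) \<le> integral\<^sup>L lebesgue (?f (inverse (real (Suc N))))"
      by (intro integral_mono int mult_right_mono levy_weight_nonneg)
         (use d in \<open>auto simp: indicator_def\<close>)
    with N show "integral\<^sup>L lebesgue (?f d) < e"
      by simp
  qed auto
qed

section \<open>Test functions\<close>

text \<open>Expand 2 |a| |a + z| \<le> |a|^2 + |a + z|^2 and divide by 2 |a|.\<close>

lemma norm_add_le_tangent:
  fixes a z :: "'a::real_inner"
  assumes "a \<noteq> 0"
  shows "norm (a + z) \<le> norm a + (a \<bullet> z) / norm a + (norm z)\<^sup>2 / (2 * norm a)"
proof -
  have "2 * norm a * norm (a + z) \<le> (norm a)\<^sup>2 + (norm (a + z))\<^sup>2"
    using sum_squares_bound[of "norm a" "norm (a + z)"] by simp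
  also have "\<dots> = 2 * (norm a)\<^sup>2 + 2 * (a \<bullet> z) + (norm z)\<^sup>2"
    by (simp add: power2_norm_eq_inner algebra_simps inner_commute)
  finally show ?thesis
    using assms by (simp add: field_simps power2_eq_square)
qed

text \<open>Concavity of the power in the form of Young's inequality for \<open>t\<close> and
  \<open>r\<close> with weights \<alpha> and 1 - \<alpha>, which requires
  \<open>t > 0\<close>.\<close>

lemma powr_le_tangent:
  fixes t r \<alpha> :: real
  assumes "0 \<le> t" "0 < r" "0 < \<alpha>" "\<alpha> < 1"
  shows "t powr \<alpha> \<le> r powr \<alpha> + \<alpha> * r powr (\<alpha> - 1) * (t - r)"
proof (cases "t = 0")
  case True
  have "\<alpha> * (r powr (\<alpha> - 1) * r) = \<alpha> * r powr \<alpha>"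
    using assms by (simp add: powr_diff)
  also have "\<dots> \<le> r powr \<alpha>"
    using assms by (intro mult_left_le_one_le) auto
  finally show ?thesis
    using True assms by (simp add: mult.assoc)
next
  case False
  have "t powr \<alpha> * r powr (1 - \<alpha>) \<le> \<alpha> * t + (1 - \<alpha>) * r"
    using assms False by (intro Youngs_inequality_0) auto
  then have "(t powr \<alpha> * r powr (1 - \<alpha>)) * r powr (\<alpha> - 1) \<le> (\<alpha> * t + (1 - \<alpha>) * r) * r powr (\<alpha> - 1)"
    by (rule mult_right_mono) simp
  moreover have "r powr (1 - \<alpha>) * r powr (\<alpha> - 1) = 1" "r powr (\<alpha> - 1) * r = r powr \<alpha>"
    using assms by (simp_all flip: powr_add add: powr_diff)
  ultimately show ?thesis
    by (simp add: algebra_simps)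
qed

text \<open>A quadratic error is o(|z|), so \<open>p\<close> is a gradient; uniqueness of
  derivatives then settles the definite description in \<open>gradient\<close>.\<close>

lemma gradient_eqI:
  fixes u :: "'a::euclidean_space \<Rightarrow> real"
  assumes "0 < r" and bound: "\<And>z. norm z < r \<Longrightarrow> \<bar>u (x + z) - u x - p \<bullet> z\<bar> \<le> M * (norm z)\<^sup>2"
  shows "gradient u x = p"
proof -
  have der: "GDERIV u x :> p"
    unfolding gderiv_def has_derivative_at
  proof (intro conjI bounded_linear_inner_left)
    show "(\<lambda>h. norm (u (x + h) - u x - h \<bullet> p) / norm h) \<midarrow>0\<rightarrow> 0"
    proof (rule Lim_null_comparison[where g="\<lambda>h. M * norm h"])
      show "\<forall>\<^sub>F h in at 0. norm (norm (u (x + h) - u x - h \<bullet> p) / norm h) \<le> M * norm h"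
        unfolding eventually_at
      proof (intro exI conjI ballI impI)
        fix h :: 'a assume "h \<noteq> 0 \<and> dist h 0 < r"
        then show "norm (norm (u (x + h) - u x - h \<bullet> p) / norm h) \<le> M * norm h"
          using bound[of h] by (simp add: inner_commute field_simps power2_eq_square)
      qed (use assms in auto)
      show "((\<lambda>h. M * norm h) \<longlongrightarrow> 0) (at 0)"
        by (auto intro!: tendsto_eq_intros)
    qed
  qed
  moreover have "p' = p" if "GDERIV u x :> p'" for p'
  proof -
    have "(\<lambda>h. h \<bullet> p') = (\<lambda>h. h \<bullet> p)"
      using der that unfolding gderiv_def by (rule has_derivative_unique[symmetric])
    then have "\<And>h. h \<bullet> (p' - p) = 0"
      by (metis cancel_comm_monoid_add_class.diff_cancel inner_diff_right)
    then show ?thesis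
      by (metis inner_eq_zero_iff right_minus_eq)
  qed
  ultimately show ?thesis
    unfolding gradient_def by (rule the_equality)
qed

text \<open>The test functions: opening upwards at \<open>x\<close> for the subsolution property,
  downwards at \<open>y\<close> for the supersolution property.\<close>

definition paraboloid :: "'a::euclidean_space \<Rightarrow> real \<Rightarrow> 'a \<Rightarrow> real \<Rightarrow> 'a \<Rightarrow> real" where
  "paraboloid x0 c p C x = c + p \<bullet> (x - x0) + C * (norm (x - x0))\<^sup>2"

lemma paraboloid_C2_on: "paraboloid x0 c p C \<in> C2_on S"
proof -
  have "GDERIV (paraboloid x0 c p C) x :> p + (2 * C) *\<^sub>R (x - x0)" for x
    unfolding gderiv_def paraboloid_def[abs_def] power2_norm_eq_inner
    by (auto intro!: derivative_eq_intros simp: inner_simps inner_commute algebra_simps)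
  moreover have "((\<lambda>x. p + (2 * C) *\<^sub>R (x - x0)) has_derivative
      blinfun_apply ((2 * C) *\<^sub>R id_blinfun)) (at x)" for x
    by (auto intro!: derivative_eq_intros simp: blinfun.scaleR_left)
  ultimately show ?thesis
    unfolding C2_on_def mem_Collect_eq
    by (intro exI[of _ "\<lambda>x. p + (2 * C) *\<^sub>R (x - x0)"]
          exI[of _ "\<lambda>_. (2 * C) *\<^sub>R id_blinfun"] conjI ballI continuous_on_const)
qed

lemma gradient_paraboloid: "gradient (paraboloid x0 c p C) x0 = p"
  by (rule gradient_eqI[of 1 _ _ _ "\<bar>C\<bar>"]) (auto simp: paraboloid_def abs_mult)

section \<open>Differences of nonlocal operators\<close>

text \<open>The first factor of the integrand of \<open>L_op\<close> in the range 1 \<le> 2s < 2,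
  with the gradient as a parameter \<open>p\<close>, so that compensators at two points can be
  compared algebraically.\<close>

definition comp_incr :: "('a::euclidean_space \<Rightarrow> real) \<Rightarrow> 'a \<Rightarrow> 'a \<Rightarrow> 'a \<Rightarrow> real" where
  "comp_incr u p x z = u (x + z) - u x - indicator (ball 0 1) z * (p \<bullet> z)"

text \<open>A convenient subclass of the domain of the operator: C11 at \<open>x\<close> with known
  gradient \<open>p\<close>, while global boundedness and Borel measurability give membership in
  \<open>L1_weight s\<close>.\<close>

definition quad_at :: "('a::euclidean_space \<Rightarrow> real) \<Rightarrow> 'a \<Rightarrow> 'a \<Rightarrow> bool" where
  "quad_at u p x \<longleftrightarrow> u \<in> borel_measurable borel \<and> bounded (range u) \<and>
     (\<exists>d M. 0 < d \<and> (\<forall>z. norm z < d \<longrightarrow> \<bar>u (x + z) - u x - p \<bullet> z\<bar> \<le> M * (norm z)\<^sup>2))"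

lemma quad_at_C11_at: "quad_at u p x \<Longrightarrow> u \<in> C11_at x"
  unfolding quad_at_def C11_at_def by blast

lemma quad_at_gradient: "quad_at u p x \<Longrightarrow> gradient u x = p"
  unfolding quad_at_def using gradient_eqI by blast

lemma quad_at_L1_weight:
  assumes "quad_at u p x" "1/2 < s" "s < 1"
  shows "u \<in> L1_weight s"
proof -
  obtain B where "\<And>y. \<bar>u y\<bar> \<le> B"
    using assms(1) by (auto simp: quad_at_def bounded_iff)
  then show ?thesis
    using assms by (intro bounded_in_L1_weight) (auto simp: quad_at_def)
qed

lemma quad_at_shift:
  assumes "quad_at u p (x + h)"
  shows "quad_at (\<lambda>y. u (y + h)) p x"
proof -
  have "bounded (range (\<lambda>y. u (y + h)))"
    using assms unfolding quad_at_def by (auto intro: bounded_subset)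
  moreover have "(\<lambda>y. u (y + h)) \<in> borel_measurable borel"
    using assms unfolding quad_at_def by auto
  ultimately show ?thesis
    using assms unfolding quad_at_def by (simp add: add.assoc add.commute[of h])
qed

lemma quad_at_comp_incr_bound:
  assumes "quad_at u p x"
  shows "\<exists>C. \<forall>z. \<bar>comp_incr u p x z\<bar> \<le> C * min (norm z) ((norm z)\<^sup>2)"
proof -
  obtain B where B: "\<And>y. \<bar>u y\<bar> \<le> B"
    using assms by (auto simp: quad_at_def bounded_iff)
  obtain d M where d: "0 < d" and M: "\<And>z. norm z < d \<Longrightarrow> \<bar>u (x + z) - u x - p \<bullet> z\<bar> \<le> M * (norm z)\<^sup>2"
    using assms by (auto simp: quad_at_def)
  have B0: "0 \<le> B"
    using B[of 0] by linarith
  \<comment> \<open>One summand per regime: the quadratic bound for |z| < d, the crude bound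
    compared with d^2 for d \<le> |z| < 1, and the oscillation of \<open>u\<close> for |z| \<ge>
    1.\<close>
  define C where "C = \<bar>M\<bar> + (2 * B + norm p) / d\<^sup>2 + 2 * B"
  have Cge: "\<bar>M\<bar> \<le> C" "(2 * B + norm p) / d\<^sup>2 \<le> C" "2 * B \<le> C"
    using B0 by (auto simp: C_def)
  have uu: "\<bar>u (x + z) - u x\<bar> \<le> 2 * B" for z
    using B[of "x + z"] B[of x] by linarith
  have "\<bar>comp_incr u p x z\<bar> \<le> C * min (norm z) ((norm z)\<^sup>2)" for z
  proof (cases "norm z < 1")
    case True
    show ?thesis
    proof (cases "norm z < d")
      case True
      have "\<bar>u (x + z) - u x - p \<bullet> z\<bar> \<le> M * (norm z)\<^sup>2"
        using True by (rule M)
      also have "\<dots> \<le> C * (norm z)\<^sup>2"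
        using Cge(1) by (intro mult_right_mono) auto
      finally show ?thesis
        using \<open>norm z < 1\<close> by (simp add: comp_incr_def min_norm_square)
    next
      case False
      have "\<bar>p \<bullet> z\<bar> \<le> norm p * norm z"
        by (rule Cauchy_Schwarz_ineq2)
      also have "\<dots> \<le> norm p"
        using \<open>norm z < 1\<close> by (intro mult_left_le) auto
      finally have "\<bar>u (x + z) - u x - p \<bullet> z\<bar> \<le> 2 * B + norm p"
        using uu[of z] by linarith
      also have "\<dots> = (2 * B + norm p) / d\<^sup>2 * d\<^sup>2"
        using d by simp
      also have "\<dots> \<le> C * (norm z)\<^sup>2"
        using Cge d False B0 by (intro mult_mono power_mono) (auto simp: C_def)
      finally show ?thesis
        using \<open>norm z < 1\<close> by (simp add: comp_incr_def min_norm_square)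
    qed
  next
    case False
    have "2 * B \<le> C * norm z"
      using Cge(3) False B0 mult_mono[of "2 * B" C 1 "norm z"] by simp
    then show ?thesis
      using uu[of z] False by (simp add: comp_incr_def min_norm_square)
  qed
  then show ?thesis
    by blast
qed

lemma quad_at_integrable:
  assumes q: "quad_at u p x" and s: "1/2 < s" "s < 1" and "0 < lam"
    and K: "K \<in> kernels s lam Lam"
  shows "integrable lebesgue (\<lambda>z. comp_incr u p x z * K z)"
proof -
  obtain C where C: "\<And>z. \<bar>comp_incr u p x z\<bar> \<le> C * min (norm z) ((norm z)\<^sup>2)"
    using quad_at_comp_incr_bound[OF q] by blast
  have [measurable]: "u \<in> borel_measurable borel"
    using q by (simp add: quad_at_def)
  have "integrable lebesgue (\<lambda>z::'a. C * Lam * levy_weight s z)"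
    using s by (intro integrable_mult_right integrable_levy_weight)
  then show ?thesis
  proof (rule Bochner_Integration.integrable_bound)
    have "comp_incr u p x \<in> borel_measurable borel"
      unfolding comp_incr_def[abs_def] by measurable
    then show "(\<lambda>z. comp_incr u p x z * K z) \<in> borel_measurable lebesgue"
      using K by (intro borel_measurable_times) (auto simp: kernels_def measurable_completion)
    have "\<bar>comp_incr u p x z * K z\<bar> \<le> C * Lam * levy_weight s z" for z
    \<comment> \<open>The kernel is arbitrary at the origin, but the increment vanishes
      there.\<close>
    proof (cases "z = 0")
      case False
      have Kz: "0 \<le> K z" "K z \<le> Lam / norm z powr (real DIM('a) + 2 * s)"
        using K False \<open>0 < lam\<close> order_trans[of 0 "lam / norm z powr (real DIM('a) + 2 * s)" "K z"]
        by (auto simp: kernels_def)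
      have "\<bar>comp_incr u p x z * K z\<bar>
          \<le> (C * min (norm z) ((norm z)\<^sup>2)) * (Lam / norm z powr (real DIM('a) + 2 * s))"
        unfolding abs_mult using Kz C[of z] abs_ge_zero[of "comp_incr u p x z"]
        by (intro mult_mono) auto
      then show ?thesis
        by (simp add: levy_weight_def ac_simps)
    qed (simp add: comp_incr_def levy_weight_def)
    then show "AE z in lebesgue. norm (comp_incr u p x z * K z) \<le> norm (C * Lam * levy_weight s z)"
      by (intro AE_I2) (metis abs_ge_self order_trans real_norm_def)
  qed
qed

lemma L_op_eq_comp_incr:
  assumes "quad_at u p x" "1/2 < s" "s < 1"
  shows "L_op s K u x = (LINT z|lebesgue. comp_incr u p x z * K z)"
  using assms by (simp add: L_op_def comp_incr_def quad_at_gradient)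

lemma kernels_nonempty:
  assumes "lam \<le> Lam"
  shows "kernels s lam Lam \<noteq> ({} :: ('a::euclidean_space \<Rightarrow> real) set)"
proof -
  have "(\<lambda>z::'a. lam / norm z powr (real DIM('a) + 2 * s)) \<in> borel_measurable lebesgue"
    by (rule measurable_completion) measurable
  then have "(\<lambda>z::'a. lam / norm z powr (real DIM('a) + 2 * s)) \<in> kernels s lam Lam"
    using assms by (auto simp: kernels_def intro!: divide_right_mono)
  then show ?thesis
    by blast
qed

text \<open>Ellipticity compares two functions at one point. Translation invariance therefore moves
  \<open>w\<close> from \<open>y\<close> to \<open>x\<close>, which preserves its compensated
  increments; a bound uniform in \<open>K\<close> then bounds the supremum over the nonempty kernel
  class.\<close>

lemma operator_difference_le:
  assumes s: "1/2 < s" "s < 1" and lam: "0 < lam" "lam \<le> Lam"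
    and ti: "translation_invariant s I" and el: "elliptic s lam Lam I"
    and v: "quad_at v p x" and w: "quad_at w p' y"
    and B: "\<And>K. K \<in> kernels s lam Lam \<Longrightarrow>
      (LINT z|lebesgue. (comp_incr v p x z - comp_incr w p' y z) * K z) \<le> B"
  shows "I v x - I w y \<le> B"
proof -
  define w' where "w' = (\<lambda>t. w (t + (y - x)))"
  have w': "quad_at w' p' x"
    unfolding w'_def using w by (intro quad_at_shift) simp
  have "w \<in> C11_at (x + (y - x)) \<inter> L1_weight s"
    using quad_at_C11_at[OF w] quad_at_L1_weight[OF w s] by simp
  then have "I w' x = I w (x + (y - x))"
    using ti unfolding translation_invariant_def w'_def by blast
  then have "I v x - I w y = I v x - I w' x"
    by simp
  also have "\<dots> \<le> (SUP K\<in>kernels s lam Lam. L_op s K v x - L_op s K w' x)"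
    using el quad_at_C11_at[OF v] quad_at_C11_at[OF w'] quad_at_L1_weight[OF v s]
      quad_at_L1_weight[OF w' s] unfolding elliptic_def by blast
  also have "\<dots> \<le> B"
  proof (rule cSUP_least[OF kernels_nonempty[OF lam(2)]])
    fix K :: "'a \<Rightarrow> real" assume K: "K \<in> kernels s lam Lam"
    have ci: "comp_incr w' p' x z = comp_incr w p' y z" for z
      by (simp add: comp_incr_def w'_def algebra_simps)
    have "L_op s K v x - L_op s K w' x
        = (LINT z|lebesgue. comp_incr v p x z * K z - comp_incr w' p' x z * K z)"
      using quad_at_integrable[OF v s lam(1) K] quad_at_integrable[OF w' s lam(1) K]
      by (simp add: L_op_eq_comp_incr[OF v s] L_op_eq_comp_incr[OF w' s])
    also have "\<dots> \<le> B"
      using B[OF K] by (simp add: ci left_diff_distrib)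
    finally show "L_op s K v x - L_op s K w' x \<le> B" .
  qed
  finally show ?thesis .
qed

text \<open>
  As the norm of \<open>(1, x)\<close>, the Japanese bracket \<open>(1 + |x|\<^sup>2)\<^sup>1\<^sup>/\<^sup>2\<close> inherits its Lipschitz and second order
  bounds from the norm.  It serves as the penalization; being Lipschitz suffices at infinity as \<open>2 s > 1\<close>.
\<close>

definition bracket :: "'a::euclidean_space \<Rightarrow> real" where
  "bracket x = norm (1::real, x)"

lemma bracket_ge: "1 \<le> bracket x" "norm x \<le> bracket x"
  using norm_fst_le[of "1::real" x] norm_snd_le[of x "1::real"] by (simp_all add: bracket_def)

lemma bracket_Lipschitz: "bracket (x + z) \<le> bracket x + norm z"
  using norm_triangle_ineq[of "(1::real, x)" "(0, z)"] by (simp add: bracket_def norm_Pair)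

lemma bracket_le_tangent: "bracket (x + z) \<le> bracket x + (x /\<^sub>R bracket x) \<bullet> z + (norm z)\<^sup>2 / 2"
proof -
  have "bracket (x + z) \<le> bracket x + (x \<bullet> z) / bracket x + (norm z)\<^sup>2 / (2 * bracket x)"
    using norm_add_le_tangent[of "(1::real, x)" "(0, z)"] by (simp add: bracket_def norm_Pair zero_prod_def)
  also have "(norm z)\<^sup>2 / (2 * bracket x) \<le> (norm z)\<^sup>2 / 2"
    using bracket_ge(1)[of x] by (intro divide_left_mono) auto
  finally show ?thesis
    by (simp add: field_simps)
qed

lemma norm_bracket_gradient: "norm (x /\<^sub>R bracket x) \<le> 1"
  using bracket_ge[of x] by (simp add: field_simps)

lemma continuous_on_bracket [continuous_intros]:
  "continuous_on S f \<Longrightarrow> continuous_on S (\<lambda>x. bracket (f x))"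
  unfolding bracket_def by (intro continuous_intros)

text \<open>Inside the ball the compensator cancels the linear part exactly, as
  \<open>d \<le> 1\<close> keeps it active. Outside nothing changes, since the paraboloid has the
  value of \<open>u\<close> at \<open>x\<close>.\<close>

lemma glue_paraboloid:
  fixes u :: "'a::euclidean_space \<Rightarrow> real" and x z p :: 'a and C d :: real
  assumes u: "u \<in> borel_measurable borel" "bounded (range u)" and d: "0 < d"
  defines "v \<equiv> glue x d (paraboloid x (u x) p C) u"
  shows "quad_at v p x" "d \<le> 1 \<Longrightarrow> norm z < d \<Longrightarrow> comp_incr v p x z = C * (norm z)\<^sup>2"
    "d \<le> norm z \<Longrightarrow> comp_incr v p x z = comp_incr u p x z"
proof -
  have vx: "v x = u x"
    using d by (simp add: v_def glue_def paraboloid_def)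
  have inside: "v (x + z) - v x - p \<bullet> z = C * (norm z)\<^sup>2" if "norm z < d" for z
    unfolding vx using that by (simp add: v_def glue_def paraboloid_def dist_norm)
  show "d \<le> norm z \<Longrightarrow> comp_incr v p x z = comp_incr u p x z"
    unfolding comp_incr_def vx by (simp add: v_def glue_def dist_norm)
  show "d \<le> 1 \<Longrightarrow> norm z < d \<Longrightarrow> comp_incr v p x z = C * (norm z)\<^sup>2"
    using inside[of z] by (simp add: comp_incr_def)
  have "v \<in> borel_measurable borel"
    unfolding v_def glue_def[abs_def] paraboloid_def[abs_def] using u(1) by measurable
  moreover have "bounded (range v)"
  proof -
    obtain B where B: "\<And>y. \<bar>u y\<bar> \<le> B"
      using u(2) by (auto simp: bounded_iff)
    have "\<bar>v y\<bar> \<le> B + norm p * d + \<bar>C\<bar> * d\<^sup>2" for y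
    proof (cases "y \<in> ball x d")
      case True
      have "\<bar>p \<bullet> (y - x)\<bar> \<le> norm p * norm (y - x)"
        by (rule Cauchy_Schwarz_ineq2)
      also have "\<dots> \<le> norm p * d"
        using True by (intro mult_left_mono) (auto simp: dist_norm norm_minus_commute)
      finally have "\<bar>p \<bullet> (y - x)\<bar> \<le> norm p * d" .
      moreover have "\<bar>C * (norm (y - x))\<^sup>2\<bar> \<le> \<bar>C\<bar> * d\<^sup>2"
        using True unfolding abs_mult
        by (intro mult_mono) (auto simp: dist_norm norm_minus_commute intro!: power_mono)
      ultimately show ?thesis
        using True B[of x] by (simp add: v_def glue_def paraboloid_def)
    next
      case False
      moreover have "0 \<le> norm p * d + \<bar>C\<bar> * d\<^sup>2"
        using d by simp
      ultimately show ?thesis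
        using B[of y] by (simp add: v_def glue_def)
    qed
    then show ?thesis
      by (auto simp: bounded_iff)
  qed
  moreover have "\<exists>d M. 0 < d \<and> (\<forall>z. norm z < d \<longrightarrow> \<bar>v (x + z) - v x - p \<bullet> z\<bar> \<le> M * (norm z)\<^sup>2)"
    using d inside by (intro exI[of _ d] exI[of _ "\<bar>C\<bar>"]) (auto simp: abs_mult)
  ultimately show "quad_at v p x"
    by (simp add: quad_at_def)
qed

section \<open>Doubling of variables\<close>

text \<open>Two bounds for one difference \<open>I v x - I w y\<close>, with \<open>v\<close> and
  \<open>w\<close> the glued tests: the equation bounds it from below by the gradient term, the
  maximum from above by minus the left-hand side plus errors proportional to
  \<open>e\<close>.\<close>

lemma doubling_maximum_estimate:
  fixes u :: "'a::euclidean_space \<Rightarrow> real" and x y :: 'a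
  assumes s: "1/2 < s" "s < 1" and lam: "0 < lam" "lam \<le> Lam"
    and ti: "translation_invariant s I" and el: "elliptic s lam Lam I" and "0 \<le> m" "0 \<le> q"
    and u: "u \<in> borel_measurable borel" "\<And>t. 0 < u t" "\<And>t. u t \<le> M"
    and sol: "visc_solution s I (\<lambda>x t p. - (t powr q * norm p powr m)) UNIV {0<..} u"
    and al: "0 < al" "al < 1" and L: "0 < L" and e: "0 < e"
    and kap: "0 < kap" "kap < 1/2" "(2 + kap) powr al + kap powr al \<le> 2 - eta" "0 < eta"
    and max: "\<And>x' y'. u x' - u y' - L * norm (x' - y') powr al - e * bracket x'
        \<le> u x - u y - L * norm (x - y) powr al - e * bracket x"
    and "x \<noteq> y"
  defines "r \<equiv> norm (x - y)"
  shows "eta * lam * 2 powr (- real DIM('a) - 2 * s) * kap ^ DIM('a) * unit_ball_vol (DIM('a))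
        * L * r powr (al - 2 * s)
      \<le> M powr q * (L * al * r powr (al - 1) + e) powr m
        + e * (Lam * (LINT z|lebesgue. levy_weight s (z::'a)) + 1)"
proof -
  let ?b = "real DIM('a) + 2 * s"
  define a where "a = x - y"
  \<comment> \<open>\<open>p'\<close> is the gradient of \<open>L\<close> times the
    \<open>al\<close>-th power of the norm at \<open>a\<close>, and \<open>C'\<close> the second
    order coefficient from composing the two tangent inequalities. Only \<open>x\<close> is
    penalized, so \<open>p\<close> and \<open>C\<close> carry the extra terms of
    \<open>bracket\<close>.\<close>
  define p' where "p' = (L * al * r powr (al - 1)) *\<^sub>R (a /\<^sub>R r)"
  define g where "g = x /\<^sub>R bracket x"
  define p where "p = p' + e *\<^sub>R g"
  define C' where "C' = L * al * r powr (al - 1) / (2 * r)"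
  define C where "C = C' + e / 2"
  have r: "0 < r" "norm a = r" "a \<noteq> 0"
    using \<open>x \<noteq> y\<close> by (auto simp: r_def a_def)
  have C'0: "0 \<le> C'"
    using r L al by (simp add: C'_def)
  have bd: "bounded (range u)"
    using u(2,3) by (auto simp: bounded_iff abs_of_pos)
  have M0: "0 < M"
    using u(2,3)[of x] by linarith

  \<comment> \<open>Increments at the maximum point\<close>
  have radial: "L * norm (a + z) powr al \<le> L * r powr al + p' \<bullet> z + C' * (norm z)\<^sup>2" for z
  proof -
    have "norm (a + z) powr al \<le> r powr al + al * r powr (al - 1) * (norm (a + z) - r)"
      using r al by (intro powr_le_tangent) auto
    also have "\<dots> \<le> r powr al + al * r powr (al - 1) * ((a \<bullet> z) / r + (norm z)\<^sup>2 / (2 * r))"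
      using norm_add_le_tangent[OF r(3), of z] al r
      by (intro add_left_mono mult_left_mono) auto
    finally have "L * norm (a + z) powr al
        \<le> L * (r powr al + al * r powr (al - 1) * ((a \<bullet> z) / r + (norm z)\<^sup>2 / (2 * r)))"
      using L by (intro mult_left_mono) auto
    also have "\<dots> = L * r powr al + p' \<bullet> z + C' * (norm z)\<^sup>2"
      using r by (simp add: p'_def C'_def field_simps)
    finally show ?thesis .
  qed
  \<comment> \<open>The maximum is tested by moving \<open>x\<close> alone, \<open>y\<close> alone,
    and both in parallel; the parallel move keeps \<open>x - y\<close> fixed and leaves only the
    penalization.\<close>
  have move_x: "u (x + z) - u x
      \<le> L * norm (a + z) powr al - L * r powr al + e * (bracket (x + z) - bracket x)" for z
    using max[of "x + z" y] by (simp add: a_def r_def algebra_simps)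
  have move_y: "u y - u (y + z) \<le> L * norm (a - z) powr al - L * r powr al" for z
    using max[of x "y + z"] by (simp add: a_def r_def algebra_simps)
  have move_xy: "u (x + z) - u x - (u (y + z) - u y) \<le> e * (bracket (x + z) - bracket x)" for z
    using max[of "x + z" "y + z"] by (simp add: a_def r_def algebra_simps)
  have bracket_quad: "e * (bracket (x + z) - bracket x) \<le> e * (g \<bullet> z) + e / 2 * (norm z)\<^sup>2" for z
    using mult_left_mono[OF bracket_le_tangent[of x z], of e] e by (simp add: g_def algebra_simps)
  have bracket_incr: "e * (bracket (x + z) - bracket x) - indicator (ball 0 1) z * (e *\<^sub>R g \<bullet> z)
      \<le> e * min (norm z) ((norm z)\<^sup>2)" for z
  proof (cases "norm z < 1")
    case True
    have "e / 2 * (norm z)\<^sup>2 \<le> e * (norm z)\<^sup>2"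
      using e by (intro mult_right_mono) auto
    then show ?thesis
      using True bracket_quad[of z] by (simp add: min_norm_square)
  next
    case False
    have "e * (bracket (x + z) - bracket x) \<le> e * norm z"
      using bracket_Lipschitz[of x z] e by (intro mult_left_mono) auto
    then show ?thesis
      using False by (simp add: min_norm_square)
  qed

  \<comment> \<open>The radius \<open>d\<close> of the tests is so small that their quadratic parts cost at most \<open>e\<close>; the gain comes
    from \<open>z\<close> in \<open>ball a (kap * r)\<close>, where \<open>|a - z|\<close> is tiny and \<open>|a + z|\<close> is about \<open>2 r\<close>.\<close>
  define c where "c = e / (Lam * (C + C') + 1)"
  have Lam0: "0 < Lam" and C0: "0 \<le> C"
    using lam C'0 e by (auto simp: C_def)
  have c0: "0 < c"
    using e Lam0 C0 C'0 by (auto simp: c_def intro!: divide_pos_pos add_nonneg_pos)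
  obtain d0 where d0: "0 < d0"
    and small: "\<And>d. 0 < d \<Longrightarrow> d \<le> d0 \<Longrightarrow>
      (LINT z|lebesgue. indicator (ball (0::'a) d) z * levy_weight s z) < c"
    using levy_weight_small_ball[OF s c0, where 'a='a] by blast
  define d where "d = Min {d0, r / 2, 1}"
  have d: "0 < d" "d \<le> d0" "d \<le> r / 2" "d \<le> 1"
    using d0 r by (auto simp: d_def)
  define v where "v = glue x d (paraboloid x (u x) p C) u"
  define w where "w = glue y d (paraboloid y (u y) p' (- C')) u"
  note v = glue_paraboloid[OF u(1) bd d(1), where x=x and p=p and C=C, folded v_def]
  note w = glue_paraboloid[OF u(1) bd d(1), where x=y and p=p' and C="- C'", folded w_def]

  \<comment> \<open>The equation tested at both points\<close>
  have "- I v x + - (u x powr q * norm p powr m) \<le> 0"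
  proof -
    have "u t \<le> paraboloid x (u x) p C t" for t
      using move_x[of "t - x"] radial[of "t - x"] bracket_quad[of "t - x"]
      by (simp add: paraboloid_def p_def C_def algebra_simps)
    then show ?thesis
      using sol d(1) quad_at_L1_weight[OF v(1) s] paraboloid_C2_on[of x "u x" p C]
      unfolding visc_solution_def visc_subsolution_def v_def
      by (metis (no_types, lifting) UNIV_I gradient_paraboloid paraboloid_def add.right_neutral
          diff_self inner_zero_right mult_zero_right norm_zero power_zero_numeral)
  qed
  moreover have "0 \<le> - I w y + - (u y powr q * norm p' powr m)"
  proof -
    have "paraboloid y (u y) p' (- C') t \<le> u t" for t
      \<comment> \<open>Moving \<open>y\<close> by \<open>z\<close> changes \<open>a\<close> to
        \<open>a - z\<close>. Hence \<open>radial\<close> enters with the opposite sign and the test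
        from below has the same gradient \<open>p'\<close>.\<close>
      using move_y[of "t - y"] radial[of "- (t - y)"]
      by (simp add: paraboloid_def norm_minus_commute[of t y] algebra_simps)
    then show ?thesis
      using sol d(1) quad_at_L1_weight[OF w(1) s] paraboloid_C2_on[of y "u y" p' "- C'"]
      unfolding visc_solution_def visc_supersolution_def w_def
      by (metis (no_types, lifting) UNIV_I gradient_paraboloid paraboloid_def add.right_neutral
          diff_self inner_zero_right mult_zero_right norm_zero power_zero_numeral)
  qed
  \<comment> \<open>The gradient term at \<open>y\<close> has the favourable sign: it gives
    \<open>I w y \<le> 0\<close>, so only the term at \<open>x\<close> survives in
    \<open>below\<close>.\<close>
  moreover have "0 \<le> u y powr q * norm p' powr m"
    by simp
  moreover have "u x powr q * norm p powr m \<le> M powr q * (L * al * r powr (al - 1) + e) powr m"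
  proof (intro mult_mono powr_mono2)
    have "norm p \<le> norm p' + norm (e *\<^sub>R g)"
      unfolding p_def by (rule norm_triangle_ineq)
    also have "norm p' = L * al * r powr (al - 1)"
      using L al r by (simp add: p'_def abs_mult)
    also have "norm (e *\<^sub>R g) \<le> e"
      using e norm_bracket_gradient[of x] by (simp add: g_def[symmetric] mult_left_le)
    finally show "norm p \<le> L * al * r powr (al - 1) + e"
      by simp
  qed (use u(2,3)[of x] \<open>0 \<le> m\<close> \<open>0 \<le> q\<close> in auto)
  ultimately have below: "- (M powr q * (L * al * r powr (al - 1) + e) powr m) \<le> I v x - I w y"
    by linarith

  \<comment> \<open>Upper bound for the difference of the operators\<close>
  define D where "D = ball a (kap * r)"
  \<comment> \<open>\<open>G\<close> is the drop of the increment on \<open>D\<close>;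
    \<open>A\<close> multiplies it by the least kernel value there, attained at worst where |z| =
    2r.\<close>
  define G where "G = L * r powr al * eta"
  define A where "A = G * (lam / (2 * r) powr ?b)"
  have G0: "0 \<le> G"
    using L kap by (simp add: G_def)
  \<comment> \<open>Triangle inequalities around \<open>a\<close> with \<open>kap < 1/2\<close>. The
    first one separates \<open>D\<close> from the ball of radius \<open>d \<le> r / 2\<close> where
    the tests replace \<open>u\<close>.\<close>
  have D: "r / 2 < norm z" "norm z \<le> 2 * r" "norm (a - z) \<le> kap * r" "norm (a + z) \<le> (2 + kap) * r"
    if "z \<in> D" for z
  proof -
    have az: "norm (a - z) < kap * r"
      using that by (simp add: D_def dist_norm)
    have kr: "kap * r < r / 2"
      using kap r by simp
    show "norm (a - z) \<le> kap * r"
      using az by simp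
    have "norm a \<le> norm z + norm (a - z)"
      using norm_triangle_ineq[of z "a - z"] by simp
    then show "r / 2 < norm z"
      using az kr r by linarith
    have "norm z \<le> norm a + norm (a - z)"
      using norm_triangle_ineq4[of a "a - z"] by simp
    then show "norm z \<le> 2 * r"
      using az kr r by linarith
    have "norm (a + z) \<le> 2 * norm a + norm (a - z)"
      using norm_triangle_ineq[of a a] norm_triangle_ineq4[of "a + a" "a - z"] by simp
    then show "norm (a + z) \<le> (2 + kap) * r"
      using az r by (simp add: algebra_simps)
  qed
  define N where "N = (\<lambda>z. comp_incr v p x z - comp_incr w p' y z)"
  \<comment> \<open>Since \<open>p - p' = e *\<^sub>R g\<close>, the compensators of the common part
    \<open>p'\<close> cancel without any symmetry of the kernel.\<close>
  have N_u: "N z = u (x + z) - u x - (u (y + z) - u y) - indicator (ball 0 1) z * (e *\<^sub>R g \<bullet> z)"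
    if "d \<le> norm z" for z
    using v(3)[OF that] w(3)[OF that] by (simp add: N_def comp_incr_def p_def algebra_simps)
  have N_near: "N z = (C + C') * (norm z)\<^sup>2" if "norm z < d" for z
    using v(2)[OF d(4) that] w(2)[OF d(4) that] by (simp add: N_def algebra_simps)
  have N_far: "N z \<le> e * min (norm z) ((norm z)\<^sup>2)" if "d \<le> norm z" for z
    using N_u[OF that] move_xy[of z] bracket_incr[of z] by linarith
  \<comment> \<open>Here \<open>x\<close> and \<open>y\<close> are moved separately, which yields |a
    + z|^al + |a - z|^al - 2 r^al, at most - eta r^al by the choice of \<open>kap\<close>.\<close>
  have N_D: "N z \<le> e * min (norm z) ((norm z)\<^sup>2) - G" if "z \<in> D" for z
  proof -
    have "norm (a + z) powr al + norm (a - z) powr al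
        \<le> ((2 + kap) * r) powr al + (kap * r) powr al"
      using D[OF that] al by (intro add_mono powr_mono2) auto
    also have "\<dots> = ((2 + kap) powr al + kap powr al) * r powr al"
      by (simp only: powr_mult distrib_right[of "(2 + kap) powr al"])
    also have "\<dots> \<le> (2 - eta) * r powr al"
      using kap by (intro mult_right_mono) auto
    finally have "L * (norm (a + z) powr al + norm (a - z) powr al) \<le> L * ((2 - eta) * r powr al)"
      using L by (intro mult_left_mono) auto
    then show ?thesis
      using N_u[of z] D(1)[OF that] d(3) move_x[of z] move_y[of z] bracket_incr[of z]
      by (simp add: G_def algebra_simps)
  qed

  have "I v x - I w y \<le> e * Lam * (LINT z|lebesgue. levy_weight s (z::'a)) + (C + C') * Lam * c
      - A * measure lborel D"
  proof (rule operator_difference_le[OF s lam ti el v(1) w(1)])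
    fix K :: "'a \<Rightarrow> real" assume K: "K \<in> kernels s lam Lam"
    \<comment> \<open>Pointwise majorant: the penalization everywhere, the quadratic parts of the
      tests near the origin, minus the gain on \<open>D\<close>.\<close>
    let ?rhs = "\<lambda>z. e * Lam * levy_weight s z
      + (C + C') * Lam * (indicator (ball 0 d) z * levy_weight s z) - A * indicator D z"
    have int1: "integrable lebesgue (levy_weight s :: 'a \<Rightarrow> real)"
      using s by (rule integrable_levy_weight)
    have int2: "integrable lebesgue (\<lambda>z::'a. indicator (ball 0 d) z * levy_weight s z)"
      using int1 by (rule Bochner_Integration.integrable_bound)
        (auto simp: measurable_completion indicator_def)
    have int3: "integrable lebesgue (indicator D :: 'a \<Rightarrow> real)"
      using kap r by (intro integrable_real_indicator) (auto simp: D_def emeasure_ball)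
    have "(LINT z|lebesgue. N z * K z) \<le> (LINT z|lebesgue. ?rhs z)"
    proof (rule integral_mono)
      show "integrable lebesgue (\<lambda>z. N z * K z)"
        using quad_at_integrable[OF v(1) s lam(1) K] quad_at_integrable[OF w(1) s lam(1) K]
        by (simp add: N_def left_diff_distrib)
      show "integrable lebesgue ?rhs"
        using int1 int2 int3 by simp
      fix z :: 'a
      show "N z * K z \<le> ?rhs z"
      proof (cases "z = 0")
        case True
        then have "z \<notin> D"
          using D(1)[of z] r by auto
        then show ?thesis
          using True by (simp add: N_def comp_incr_def levy_weight_def)
      next
        case False
        have K_le: "K z \<le> Lam / norm z powr ?b" and K_ge: "lam / norm z powr ?b \<le> K z"
          using K False by (auto simp: kernels_def)
        have K0: "0 \<le> K z"
          using K_ge lam by (meson divide_nonneg_nonneg less_imp_le order_trans powr_ge_zero)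
        have lw: "min (norm z) ((norm z)\<^sup>2) * K z \<le> Lam * levy_weight s z"
          using mult_left_mono[OF K_le, of "min (norm z) ((norm z)\<^sup>2)"]
          by (simp add: levy_weight_def mult.commute)
        have e_lw: "e * min (norm z) ((norm z)\<^sup>2) * K z \<le> e * Lam * levy_weight s z"
          using mult_left_mono[OF lw, of e] e by (simp add: mult.assoc)
        consider "z \<in> D" | "z \<notin> D" "norm z < d" | "z \<notin> D" "d \<le> norm z"
          by linarith
        then show ?thesis
        proof cases
          case 1
          have "d \<le> norm z"
            using D(1)[OF 1] d(3) by linarith
          have "norm z powr ?b \<le> (2 * r) powr ?b"
            using D(2)[OF 1] s by (intro powr_mono2) auto
          then have "lam / (2 * r) powr ?b \<le> lam / norm z powr ?b"
            using False lam r by (intro divide_left_mono) auto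
          also have "\<dots> \<le> K z"
            by (rule K_ge)
          finally have "A \<le> G * K z"
            unfolding A_def using G0 by (rule mult_left_mono)
          moreover have "N z * K z \<le> e * min (norm z) ((norm z)\<^sup>2) * K z - G * K z"
            using mult_right_mono[OF N_D[OF 1] K0] by (simp add: left_diff_distrib)
          ultimately show ?thesis
            using e_lw 1 \<open>d \<le> norm z\<close> by simp
        next
          case 2
          have "N z * K z = (C + C') * (min (norm z) ((norm z)\<^sup>2) * K z)"
            using N_near[OF 2(2)] 2 d(4) by (simp add: min_norm_square)
          also have "\<dots> \<le> (C + C') * (Lam * levy_weight s z)"
            using lw C0 C'0 by (intro mult_left_mono) auto
          also have "\<dots> \<le> ?rhs z"
            using 2 e Lam0 levy_weight_nonneg[of s z] by simp
          finally show ?thesis .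
        next
          case 3
          then show ?thesis
            using mult_right_mono[OF N_far[OF 3(2)] K0] e_lw by simp
        qed
      qed
    qed
    also have "\<dots> = e * Lam * (LINT z|lebesgue. levy_weight s (z::'a))
        + (C + C') * Lam * (LINT z|lebesgue. indicator (ball (0::'a) d) z * levy_weight s z)
        - A * measure lborel D"
      using int1 int2 int3 by (simp add: D_def)
    also have "\<dots> \<le> e * Lam * (LINT z|lebesgue. levy_weight s (z::'a)) + (C + C') * Lam * c
        - A * measure lborel D"
      using small[OF d(1,2)] C0 C'0 Lam0 by (intro diff_right_mono add_left_mono mult_left_mono) auto
    finally show "(LINT z|lebesgue. (comp_incr v p x z - comp_incr w p' y z) * K z)
        \<le> e * Lam * (LINT z|lebesgue. levy_weight s (z::'a)) + (C + C') * Lam * c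
          - A * measure lborel D"
      by (simp add: N_def)
  qed
  moreover have "(C + C') * Lam * c \<le> e"
  proof -
    have "0 \<le> Lam * (C + C')"
      using Lam0 C0 C'0 by simp
    then show ?thesis
      using e by (simp add: c_def divide_simps algebra_simps)
  qed
  \<comment> \<open>The volume of \<open>D\<close> supplies r^n, which cancels the dimension in the
    kernel bound and leaves the exponent al - 2s.\<close>
  moreover have "A * measure lborel D
      = eta * lam * 2 powr (- real DIM('a) - 2 * s) * kap ^ DIM('a) * unit_ball_vol (DIM('a))
        * L * r powr (al - 2 * s)"
  proof -
    have mD: "measure lborel D = unit_ball_vol (DIM('a)) * (kap ^ DIM('a) * r powr real DIM('a))"
      using kap r by (simp add: D_def content_ball power_mult_distrib powr_realpow)
    have A: "A = L * eta * lam * (r powr al * (2 powr (- ?b) * r powr (- ?b)))"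
      by (simp only: A_def G_def powr_minus powr_mult divide_inverse inverse_mult_distrib ac_simps)
    have rp: "r powr al * r powr (- ?b) * r powr real DIM('a) = r powr (al - 2 * s)"
      by (simp flip: powr_add)
    have b: "- ?b = - real DIM('a) - 2 * s"
      by simp
    have "A * measure lborel D = eta * lam * 2 powr (- ?b) * kap ^ DIM('a) * unit_ball_vol (DIM('a))
        * L * (r powr al * r powr (- ?b) * r powr real DIM('a))"
      unfolding A mD by (simp only: ac_simps)
    then show ?thesis
      unfolding rp unfolding b .
  qed
  ultimately show ?thesis
    using below by (simp add: algebra_simps)
qed

text \<open>As \<open>kap\<close> tends to 0 the sum tends to 2^al < 2; continuity keeps it below 2
  for small \<open>kap\<close>, and \<open>eta\<close> is the remaining gap.\<close>

lemma concavity_gain: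
  fixes al :: real
  assumes "0 < al" "al < 1"
  shows "\<exists>kap eta. 0 < kap \<and> kap < 1/2 \<and> (2 + kap) powr al + kap powr al \<le> 2 - eta \<and> 0 < eta"
proof -
  let ?h = "\<lambda>k::real. (2 + k) powr al + k powr al"
  have lim: "(?h \<longlongrightarrow> (2 + 0) powr al + 0) (at_right 0)"
  proof (intro tendsto_intros)
    show "((\<lambda>k. k powr al) \<longlongrightarrow> 0) (at_right 0)"
      using assms by (intro tendsto_zero_powrI tendsto_intros)
        (auto simp: eventually_at_right_less intro: eventually_mono[OF eventually_at_right_less])
  qed auto
  have "(2::real) powr al < 2 powr 1"
    using assms by (intro powr_less_mono) auto
  then have "\<forall>\<^sub>F k in at_right 0. ?h k < 2"
    using lim by (intro order_tendstoD) auto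
  moreover have "\<forall>\<^sub>F k in at_right 0. k < (1/2::real)"
    by (intro order_tendstoD[OF tendsto_ident_at]) auto
  moreover have "\<forall>\<^sub>F k in at_right 0. (0::real) < k"
    by (rule eventually_at_right_less)
  ultimately have "\<forall>\<^sub>F k in at_right 0. 0 < k \<and> k < 1/2 \<and> ?h k < (2::real)"
    by eventually_elim auto
  then obtain k where "0 < k" "k < 1/2" "?h k < 2"
    using eventually_happens[of _ "at_right (0::real)"] by (auto simp: trivial_limit_at_right_real)
  then show ?thesis
    by (intro exI[of _ k] exI[of _ "2 - ?h k"]) auto
qed

text \<open>The superlevel set through \<open>(x0, y0)\<close> is compact: on it the penalization
  bounds \<open>x\<close>, and the coupling term bounds \<open>x - y\<close>. A maximum over this
  set is global.\<close>

lemma penalized_maximum: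
  fixes u :: "'a::euclidean_space \<Rightarrow> real"
  assumes u: "continuous_on UNIV u" "\<And>t. 0 < u t" "\<And>t. u t \<le> M"
    and pos: "0 < L" "0 < e" "0 < al"
  defines "F \<equiv> \<lambda>x y. u x - u y - L * norm (x - y) powr al - e * bracket x"
  assumes F0: "0 < F x0 y0"
  shows "\<exists>x y. (\<forall>x' y'. F x' y' \<le> F x y) \<and> 0 < F x y"
proof -
  define S where "S = {p. F x0 y0 \<le> F (fst p) (snd p)}"
  have cont: "continuous_on UNIV (\<lambda>p. F (fst p) (snd p))"
    unfolding F_def using pos
    by (intro continuous_intros continuous_on_powr' continuous_on_compose2[OF u(1)]) auto
  have "closed S"
    unfolding S_def by (intro closed_Collect_le cont continuous_on_const)
  moreover have "bounded S"
    unfolding bounded_iff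
  proof (intro exI ballI)
    fix p assume "p \<in> S"
    obtain x y where p: "p = (x, y)"
      by (cases p)
    have "0 < F x y"
      using \<open>p \<in> S\<close> F0 by (simp add: S_def p)
    moreover have "u x - u y \<le> M"
      using u(2)[of y] u(3)[of x] by linarith
    ultimately have sum: "L * norm (x - y) powr al + e * bracket x \<le> M"
      by (simp add: F_def)
    have nn: "0 \<le> L * norm (x - y) powr al" "0 \<le> e * bracket x"
      using pos bracket_ge(1)[of x] by auto
    have "e * norm x \<le> e * bracket x"
      using bracket_ge(2)[of x] pos by simp
    then have "e * norm x \<le> M"
      using sum nn by linarith
    then have 1: "norm x \<le> M / e"
      using pos by (simp add: field_simps)
    have "norm (x - y) powr al \<le> M / L"
      using sum nn pos by (simp add: field_simps)
    then have "(norm (x - y) powr al) powr (1 / al) \<le> (M / L) powr (1 / al)"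
      using pos by (intro powr_mono2) auto
    then have 2: "norm (x - y) \<le> (M / L) powr (1 / al)"
      using pos by (simp add: powr_powr)
    have "norm p \<le> norm x + norm y"
      unfolding p by (rule norm_Pair_le)
    also have "norm y \<le> norm x + norm (x - y)"
      using norm_triangle_ineq4[of x "x - y"] by simp
    finally show "norm p \<le> 2 * (M / e) + (M / L) powr (1 / al)"
      using 1 2 by linarith
  qed
  ultimately have "compact S"
    by (simp add: compact_eq_bounded_closed)
  moreover have "(x0, y0) \<in> S"
    by (simp add: S_def)
  ultimately obtain p where p: "p \<in> S" "\<And>p'. p' \<in> S \<Longrightarrow> F (fst p') (snd p') \<le> F (fst p) (snd p)"
    using continuous_attains_sup[of S "\<lambda>p. F (fst p) (snd p)"] continuous_on_subset[OF cont]
    by blast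
  have "F x' y' \<le> F (fst p) (snd p)" for x' y'
    using p(1) p(2)[of "(x', y')"] by (cases "(x', y') \<in> S") (auto simp: S_def)
  moreover have "0 < F (fst p) (snd p)"
    using p(1) F0 by (simp add: S_def)
  ultimately show ?thesis
    by blast
qed

lemma visc_solution_continuous:
  assumes "visc_solution s I H UNIV U u"
  shows "continuous_on UNIV u"
  using assms
  unfolding visc_solution_def visc_subsolution_def visc_supersolution_def usc_on_def lsc_on_def
  by (auto simp: continuous_on_def intro!: order_tendstoI)

text \<open>With (al - 1) m = al - 2s both main terms of the maximum estimate are multiples of
  \<open>P = L * r powr (al - 2 * s)\<close>. Dividing by it leaves a lower bound on L^(m-1),
  independent of the distance \<open>r\<close>.\<close>

lemma small_Hoelder_constant:
  fixes u :: "'a::euclidean_space \<Rightarrow> real"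
  assumes s: "1/2 < s" "s < 1" and lam: "0 < lam" "lam \<le> Lam"
    and ti: "translation_invariant s I" and el: "elliptic s lam Lam I"
    and m: "2 * s < m" and q: "0 \<le> q"
    and u: "\<And>t. 0 < u t" "\<And>t. u t \<le> M"
    and sol: "visc_solution s I (\<lambda>x t p. - (t powr q * norm p powr m)) UNIV {0<..} u"
  defines "al \<equiv> (m - 2 * s) / (m - 1)"
  shows "\<exists>L0>0. \<forall>L. 0 < L \<longrightarrow> L < L0 \<longrightarrow> (\<forall>x y. u x - u y \<le> L * norm (x - y) powr al)"
proof -
  have al: "0 < al" "al < 1"
    using s m by (auto simp: al_def)
  have al_m: "(al - 1) * m = al - 2 * s"
    using s m by (simp add: al_def field_simps)
  have M0: "0 < M"
    using u[of 0] by linarith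
  have cont: "continuous_on UNIV u"
    using sol by (rule visc_solution_continuous)
  then have meas: "u \<in> borel_measurable borel"
    by (rule borel_measurable_continuous_onI)
  obtain kap eta where kap: "0 < kap" "kap < 1/2" "(2 + kap) powr al + kap powr al \<le> 2 - eta" "0 < eta"
    using concavity_gain[OF al] by blast
  define c where "c = eta * lam * 2 powr (- real DIM('a) - 2 * s) * kap ^ DIM('a)
    * unit_ball_vol (DIM('a))"
  define J where "J = Lam * (LINT z|lebesgue. levy_weight s (z::'a)) + 1"
  \<comment> \<open>The factor 2 pays for absorbing \<open>e\<close> into the gradient;
    \<open>L0\<close> solves b L0^(m-1) = c/2, leaving c/4 for the penalization error and c/4 to
    spare.\<close>
  define b where "b = M powr q * (2 * al) powr m"
  define L0 where "L0 = (c / (2 * b)) powr (1 / (m - 1))"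
  have c: "0 < c"
    using kap lam by (simp add: c_def)
  have b: "0 < b"
    using M0 al by (simp add: b_def)
  have "0 \<le> (LINT z|lebesgue. levy_weight s (z::'a))"
    by (simp add: levy_weight_nonneg)
  then have J: "0 < J"
    using lam by (simp add: J_def add_nonneg_pos)
  have "u x0 - u y0 \<le> L * norm (x0 - y0) powr al" if L: "0 < L" "L < L0" for L x0 y0
  proof (rule ccontr)
    assume "\<not> ?thesis"
    then have gap: "0 < u x0 - u y0 - L * norm (x0 - y0) powr al" (is "0 < ?gap")
      by simp
    \<comment> \<open>An a priori bound for \<open>r\<close> that does not depend on
      \<open>e\<close>, since \<open>e\<close> has to be fixed before the maximum point is
      known.\<close>
    define R where "R = (M / L) powr (1 / al)"
    have R: "0 < R"
      using M0 L by (simp add: R_def)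
    \<comment> \<open>The three entries keep the penalized value at \<open>(x0, y0)\<close>
      positive, the gradient perturbation below the main gradient, and the error
      \<open>e * J\<close> below c P / 4.\<close>
    define e where "e = Min {?gap / (2 * bracket x0), L * al * R powr (al - 1),
      c * L * R powr (al - 2 * s) / (4 * J)}"
    have br0: "0 < bracket x0"
      using bracket_ge(1)[of x0] by linarith
    have e: "0 < e"
      using gap L al R c J br0 by (simp add: e_def)
    have e_le: "e \<le> ?gap / (2 * bracket x0)" "e \<le> L * al * R powr (al - 1)"
      "e \<le> c * L * R powr (al - 2 * s) / (4 * J)"
      unfolding e_def by (rule Min_le; simp)+
    have "e * bracket x0 \<le> ?gap / 2"
      using e_le(1) br0 by (simp add: field_simps)
    also have "?gap / 2 < ?gap"
      using gap by simp
    finally have "0 < ?gap - e * bracket x0"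
      by simp
    from penalized_maximum[OF cont u L(1) e al(1) this]
    obtain x y where max: "\<And>x' y'. u x' - u y' - L * norm (x' - y') powr al - e * bracket x'
        \<le> u x - u y - L * norm (x - y) powr al - e * bracket x"
      and pos: "0 < u x - u y - L * norm (x - y) powr al - e * bracket x"
      by blast
    define r where "r = norm (x - y)"
    have brx: "0 < e * bracket x"
      using e bracket_ge(1)[of x] by simp
    have "x \<noteq> y"
    proof
      assume "x = y"
      then show False
        using pos brx by simp
    qed
    then have r: "0 < r"
      by (simp add: r_def)
    have "L * r powr al \<le> M"
      using pos brx u(1)[of y] u(2)[of x] unfolding r_def by linarith
    then have "r powr al \<le> M / L"
      using L by (simp add: field_simps)
    then have "(r powr al) powr (1 / al) \<le> R"
      unfolding R_def using al by (intro powr_mono2) auto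
    then have rR: "r \<le> R"
      using al r by (simp add: powr_powr)
    define P where "P = L * r powr (al - 2 * s)"
    have P: "0 < P"
      using L r by (simp add: P_def)
    \<comment> \<open>Both exponents are negative, so the smallness of \<open>e\<close> stated with
      \<open>R\<close> passes to every \<open>r \<le> R\<close>.\<close>
    have "R powr (al - 1) \<le> r powr (al - 1)" "R powr (al - 2 * s) \<le> r powr (al - 2 * s)"
      using rR r al s by (auto intro!: powr_mono2')
    then have "L * al * R powr (al - 1) \<le> L * al * r powr (al - 1)"
      and "c * L * R powr (al - 2 * s) / (4 * J) \<le> c * P / (4 * J)"
      using L al c J by (auto simp: P_def intro!: divide_right_mono mult_left_mono)
    then have e_r: "e \<le> L * al * r powr (al - 1)" and e_P: "e * J \<le> c * P / 4"
      using e_le(2,3) J by (simp_all add: field_simps)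
    have "c * P \<le> M powr q * (L * al * r powr (al - 1) + e) powr m + e * J"
      using doubling_maximum_estimate[OF s lam ti el _ q meas u sol al L(1) e kap max \<open>x \<noteq> y\<close>] m s
      by (simp add: c_def J_def P_def r_def mult.assoc)
    also have "(L * al * r powr (al - 1) + e) powr m \<le> (2 * al * (L * r powr (al - 1))) powr m"
      using e_r e L al m s by (intro powr_mono2) auto
    also have "\<dots> = (2 * al) powr m * (L powr (m - 1) * L * r powr ((al - 1) * m))"
    proof -
      have "L powr m = L powr (m - 1) * L"
        using L by (simp add: powr_diff)
      then show ?thesis
        using L al by (simp only: powr_mult powr_powr mult.assoc)
    qed
    also have "\<dots> = (2 * al) powr m * (L powr (m - 1) * P)"
      by (simp add: al_m P_def)
    finally have le: "c * P \<le> b * L powr (m - 1) * P + c * P / 4"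
      using e_P M0 by (simp add: b_def mult_left_mono mult.assoc)
    have "L powr (m - 1) < L0 powr (m - 1)"
      using L s m by (intro powr_less_mono2) auto
    also have "\<dots> = c / (2 * b)"
      using c b s m by (simp add: L0_def powr_powr)
    finally have "b * L powr (m - 1) < c / 2"
      using b by (simp add: field_simps)
    then have "b * L powr (m - 1) * P < c / 2 * P"
      using P by (intro mult_strict_right_mono)
    moreover have "0 < c * P"
      using c P by simp
    ultimately show False
      using le by simp
  qed
  moreover have "0 < L0"
    using c b by (simp add: L0_def)
  ultimately show ?thesis
    by blast
qed

theorem theorem1p4:
  fixes s lam Lam m q :: real
    and I :: "('a::euclidean_space \<Rightarrow> real) \<Rightarrow> 'a \<Rightarrow> real"
  assumes "1/2 < s" and "s < 1"
    and "0 < lam" and "lam \<le> Lam"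
    and "translation_invariant s I"
    and "pos_homogeneous s I"
    and "elliptic s lam Lam I"
    and "m > 2 * s" and "q > 0"
  shows "\<not> (\<exists>u :: 'a \<Rightarrow> real.
            bounded (range u) \<and> (\<forall>x. u x > 0) \<and>
            visc_solution s I (\<lambda>x t p. - (t powr q * norm p powr m)) UNIV {0<..} u \<and>
            \<not> u constant_on UNIV)"
proof
  assume "\<exists>u :: 'a \<Rightarrow> real.
            bounded (range u) \<and> (\<forall>x. u x > 0) \<and>
            visc_solution s I (\<lambda>x t p. - (t powr q * norm p powr m)) UNIV {0<..} u \<and>
            \<not> u constant_on UNIV"
  then obtain u :: "'a \<Rightarrow> real" where bd: "bounded (range u)" and pos: "\<And>x. u x > 0"
    and sol: "visc_solution s I (\<lambda>x t p. - (t powr q * norm p powr m)) UNIV {0<..} u"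
    and nonconst: "\<not> u constant_on UNIV"
    by blast
  obtain M where "\<And>t. \<bar>u t\<bar> \<le> M"
    using bd by (auto simp: bounded_iff)
  then have M: "u t \<le> M" for t
    by (meson abs_le_D1)
  let ?al = "(m - 2 * s) / (m - 1)"
  obtain L0 where "0 < L0"
    and hoelder: "\<And>L x y. 0 < L \<Longrightarrow> L < L0 \<Longrightarrow> u x - u y \<le> L * norm (x - y) powr ?al"
    using small_Hoelder_constant[OF assms(1-5,7,8) less_imp_le[OF assms(9)] pos M sol] by blast
  have "u x \<le> u y" for x y
  proof -
    \<comment> \<open>Letting \<open>L\<close> tend to 0 from the right uses the bound only below
      \<open>L0\<close>; exchanging \<open>x\<close> and \<open>y\<close> then gives
      equality.\<close>
    have "((\<lambda>L. L * norm (x - y) powr ?al) \<longlongrightarrow> 0 * norm (x - y) powr ?al) (at_right 0)"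
      by (intro tendsto_intros)
    moreover have "\<forall>\<^sub>F L in at_right 0. u x - u y \<le> L * norm (x - y) powr ?al"
      unfolding eventually_at_right_field using \<open>0 < L0\<close> hoelder by blast
    ultimately have "u x - u y \<le> 0 * norm (x - y) powr ?al"
      by (intro tendsto_lowerbound) auto
    then show ?thesis
      by simp
  qed
  then have "u constant_on UNIV"
    unfolding constant_on_def by (metis order_antisym)
  with nonconst show False ..
qed

end
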